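(* There exist a non-negative function $\gamma\in H^{1/2}(\mathbb T^2)\cap L^\infty(\mathbb T^2)$ and a constant $c_0>0$ such that $$\inf_{x\in\mathbb T^2}\ \inf_{\nu\in S^1}\ \int_0^1\gamma(x+t\nu)\,dt\ \ge\ c_0 .$$ Moreover, there exist a dense open set $Z\subset\mathbb T^2$ and a measurable set $A\subset\mathbb T^2$ of positive measure such that $\gamma=0$ on $Z$ and $\gamma=1$ on $A$. Consequently, $\gamma$ is not a.e. constant, its $L^\infty$-equivalence class has no continuous representative, and $\gamma$ is not bounded below a.e. by a positive constant on any nonempty open subset of $\mathbb T^2$.
   Context: $\mathbb T^2=\mathbb R^2/\mathbb Z^2$ with Lebesgue measure; $S^1$ is the unit circle in $\mathbb R^2$; $x+t\nu$ is taken modulo $\mathbb Z^2$. Here $\gamma$ is an everywhere-defined measurable function (so line integrals make sense). $H^{1/2}(\mathbb T^2)$ is the $L^2$-based Sobolev space. *)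

theory Defs
  imports "HOL-Analysis.Analysis"
begin

definition int_lattice :: "(real ^ 2) set" where
  "int_lattice = {v. \<forall>i. v $ i \<in> \<int>}"

definition torus_rel :: "real ^ 2 \<Rightarrow> real ^ 2 \<Rightarrow> bool" where
  "torus_rel x y \<longleftrightarrow> x - y \<in> int_lattice"

lemma equivp_torus_rel: "equivp torus_rel"
proof (rule equivpI)
  show "reflp torus_rel"
    by (simp add: reflp_def torus_rel_def int_lattice_def)
  show "symp torus_rel"
  proof (rule sympI)
    fix x y assume "torus_rel x y"
    then have "- (x $ i - y $ i) \<in> \<int>" for i
      unfolding torus_rel_def int_lattice_def by (intro Ints_minus) simp
    then show "torus_rel y x" by (simp add: torus_rel_def int_lattice_def)
  qed
  show "transp torus_rel"
  proof (rule transpI)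
    fix x y z assume "torus_rel x y" "torus_rel y z"
    then have "(x $ i - y $ i) + (y $ i - z $ i) \<in> \<int>" for i
      unfolding torus_rel_def int_lattice_def by (intro Ints_add) simp_all
    then show "torus_rel x z" by (simp add: torus_rel_def int_lattice_def)
  qed
qed

quotient_type torus = "real ^ 2" / torus_rel
  by (rule equivp_torus_rel)

lift_definition torus_of :: "real ^ 2 \<Rightarrow> torus" is "\<lambda>x. x" .

instantiation torus :: topological_space
begin

definition open_torus :: "torus set \<Rightarrow> bool" where
  "open_torus U \<longleftrightarrow> open (torus_of -` U)"

instance
proof
  show "open (UNIV :: torus set)" by (simp add: open_torus_def)
  fix S T :: "torus set" assume "open S" "open T"
  then show "open (S \<inter> T)" by (simp add: open_torus_def vimage_Int open_Int)
next
  fix K :: "torus set set" assume "\<forall>S\<in>K. open S"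
  then show "open (\<Union>K)" by (auto simp add: open_torus_def vimage_Union)
qed

end

lemma continuous_torus_of: "continuous_on UNIV torus_of"
  by (simp add: continuous_on_open_vimage open_torus_def)

lift_definition torus_translate :: "torus \<Rightarrow> real ^ 2 \<Rightarrow> torus" is "\<lambda>x v. x + v"
  by (simp add: torus_rel_def)

text \<open>Lebesgue measure on the torus is the image of Lebesgue measure on the fundamental
  domain \<open>[0,1)\<^sup>2\<close>. It lives on the Borel sets, so that measurable functions are Borel
  functions and their restrictions to lines are measurable.\<close>

definition fundamental_square :: "(real ^ 2) set" where
  "fundamental_square = {x. \<forall>i. 0 \<le> x $ i \<and> x $ i < 1}"

definition torus_measure :: "torus measure" where
  "torus_measure = distr (restrict_space lborel fundamental_square) borel torus_of"

lemma sets_torus_measure [simp, measurable_cong]: "sets torus_measure = sets borel"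
  by (simp add: torus_measure_def)

lemma space_torus_measure [simp]: "space torus_measure = UNIV"
  by (simp add: torus_measure_def)

lemma fundamental_square_borel: "fundamental_square \<in> sets borel"
  unfolding fundamental_square_def by measurable

lemma emeasure_torus_measure:
  assumes "A \<in> sets borel"
  shows "emeasure torus_measure A = emeasure lborel (torus_of -` A \<inter> fundamental_square)"
proof -
  have m: "torus_of \<in> borel_measurable (restrict_space lborel fundamental_square)"
    by (intro measurable_restrict_space1) (simp add: borel_measurable_continuous_onI continuous_torus_of)
  show ?thesis
    unfolding torus_measure_def using assms fundamental_square_borel
    by (simp add: emeasure_distr[OF m] space_restrict_space emeasure_restrict_space)
qed

lift_definition torus_character :: "int ^ 2 \<Rightarrow> torus \<Rightarrow> complex"
  is "\<lambda>k x. cis (2 * pi * (\<Sum>i\<in>UNIV. of_int (k $ i) * x $ i))"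
proof -
  fix k :: "int ^ 2" and x y :: "real ^ 2"
  let ?s = "\<lambda>x. \<Sum>i\<in>UNIV. of_int (k $ i) * x $ i :: real"
  assume "torus_rel x y"
  then have "?s (x - y) \<in> \<int>"
    by (intro Ints_sum Ints_mult) (auto simp: torus_rel_def int_lattice_def)
  then have "cis (2 * pi * ?s (x - y)) = 1"
    by (rule cis_multiple_2pi)
  moreover have "2 * pi * ?s x = 2 * pi * ?s (x - y) + 2 * pi * ?s y"
    by (simp add: algebra_simps sum_subtractf)
  ultimately show "cis (2 * pi * ?s x) = cis (2 * pi * ?s y)"
    by (simp add: cis_mult [symmetric])
qed

definition fourier_coeff :: "(torus \<Rightarrow> complex) \<Rightarrow> int ^ 2 \<Rightarrow> complex" where
  "fourier_coeff f k = (\<integral>x. f x * cnj (torus_character k x) \<partial>torus_measure)"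

definition L2_torus :: "(torus \<Rightarrow> complex) set" where
  "L2_torus = {f \<in> borel_measurable torus_measure. integrable torus_measure (\<lambda>x. (cmod (f x))\<^sup>2)}"

definition Linf_torus :: "(torus \<Rightarrow> complex) set" where
  "Linf_torus = {f \<in> borel_measurable torus_measure. \<exists>C. AE x in torus_measure. cmod (f x) \<le> C}"

text \<open>The Sobolev space \<open>H\<^sup>s\<close> for \<open>s \<ge> 0\<close>, with the weights \<open>(1 + |k|\<^sup>2)\<^sup>s\<close> on the Fourier side.\<close>

definition sobolev_torus :: "real \<Rightarrow> (torus \<Rightarrow> complex) set" where
  "sobolev_torus s = {f \<in> L2_torus.
     (\<lambda>k. (1 + (\<Sum>i\<in>UNIV. (of_int (k $ i))\<^sup>2)) powr s * (cmod (fourier_coeff f k))\<^sup>2) summable_on UNIV}"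

end

(* Fix a dense sequence of points p_n and radii r_n = 4^-(n+4), and let gamma be the infimum of the
   functions 1 - bump_n, where bump_n is a Lipschitz cutoff equal to 1 on the ball of radius r_n about
   p_n and vanishing outside the ball of radius 2 r_n. A unit segment spends time O(r_n) in the n-th
   ball and sum_n r_n is small, so gamma = 1 on at least half of every unit segment, although gamma = 0
   on the dense open union of the inner balls. The n-th step of the infimum changes the function by
   O(1) on a set of area O(r_n^2) with Lipschitz constant O(1/r_n). Interpolating between L^2 and H^1,
   it has H^(1/2) norm O(sqrt r_n), which is summable. *)

theory Submission
  imports Defs "HOL-Probability.Probability_Measure"
begin

section \<open>Translations and characters of the torus\<close>

text \<open>The exponent 1/2 leaves room: in two dimensions a bump of radius \<open>r\<close> has an
  H^1 norm of order 1 however small \<open>r\<close> is, so H^1 bounds for infinitely many bumps do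
  not sum. The L^2 norm is of order \<open>r\<close>, and interpolation gives sqrt \<open>r\<close>.
  The Sobolev norm is defined through Fourier coefficients, whereas bumps are controlled through
  their increments. The bridge is translation along a coordinate axis: it preserves the measure and
  multiplies the k-th coefficient by a phase, and as the shift tends to 0 the phase differences
  produce the factor k_i^2. Weighted sums are kept over finite sets of frequencies, with bounds
  independent of the set, so that they pass to a pointwise limit. Line integrals see null sets,
  which is why gamma is an infimum taken at every point. The offset 4 in the radii makes the total
  time spent in the outer balls at most 1/6: a ball of radius 2 r_n costs at most 32 r_n.\<close>

lemma torus_of_translate: "torus_translate (torus_of x) v = torus_of (x + v)"
  by (simp add: torus_translate.abs_eq torus_of.abs_eq)

lemma torus_of_cases: obtains y where "x = torus_of y"
  by (metis torus_of.abs_eq Quotient3_abs_rep Quotient3_torus)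

lemma torus_of_eq_iff: "torus_of x = torus_of y \<longleftrightarrow> x - y \<in> int_lattice"
  by (simp add: torus_of.abs_eq torus.abs_eq_iff torus_rel_def)

text \<open>The torus carries the quotient topology, so continuity may be tested after composition
  with \<open>torus_of\<close>.\<close>

lemma continuous_on_torusI:
  fixes f :: "torus \<Rightarrow> 'a::topological_space"
  assumes "continuous_on UNIV (\<lambda>x. f (torus_of x))"
  shows "continuous_on UNIV f"
proof -
  have "open (f -` B)" if "open B" for B
  proof -
    have "open ((\<lambda>x. f (torus_of x)) -` B)"
      using assms that by (simp add: continuous_on_open_vimage)
    then show ?thesis by (simp add: open_torus_def vimage_def)
  qed
  then show ?thesis by (simp add: continuous_on_open_vimage)
qed

lemma continuous_torus_translate: "continuous_on UNIV (\<lambda>x. torus_translate x v)"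
proof (rule continuous_on_torusI)
  have "continuous_on UNIV (\<lambda>x. torus_of (x + v))"
    by (rule continuous_on_compose2[OF continuous_torus_of]) (auto intro!: continuous_intros)
  then show "continuous_on UNIV (\<lambda>x. torus_translate (torus_of x) v)"
    by (simp add: torus_of_translate)
qed

lemma measurable_torus_translate [measurable]:
  "(\<lambda>x. torus_translate x v) \<in> borel_measurable borel"
  by (rule borel_measurable_continuous_onI[OF continuous_torus_translate])

lemma emeasure_fundamental_square: "emeasure lborel fundamental_square = 1"
proof (rule antisym)
  have "fundamental_square \<subseteq> cbox 0 1"
    by (auto simp: fundamental_square_def cbox_def Basis_vec_def inner_axis less_imp_le)
  then have "emeasure lborel fundamental_square \<le> emeasure lborel (cbox 0 1 :: (real^2) set)"
    by (intro emeasure_mono) auto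
  also have "\<dots> = (\<Prod>b\<in>(Basis :: (real^2) set). (1 - 0) \<bullet> b)"
    by (intro emeasure_lborel_cbox) (auto simp: Basis_vec_def inner_axis)
  also have "(\<Prod>b\<in>(Basis :: (real^2) set). (1 - 0) \<bullet> b) = 1"
    by (intro prod.neutral) (auto simp: Basis_vec_def inner_axis)
  finally show "emeasure lborel fundamental_square \<le> 1" by simp
next
  have "(box 0 1 :: (real^2) set) \<subseteq> fundamental_square"
    by (auto simp: fundamental_square_def mem_box_cart less_imp_le)
  then have "emeasure lborel (box 0 1 :: (real^2) set) \<le> emeasure lborel fundamental_square"
    using fundamental_square_borel by (intro emeasure_mono) auto
  moreover have "emeasure lborel (box 0 1 :: (real^2) set) = (\<Prod>b\<in>(Basis :: (real^2) set). (1 - 0) \<bullet> b)"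
    by (intro emeasure_lborel_box) (auto simp: Basis_vec_def inner_axis)
  moreover have "(\<Prod>b\<in>(Basis :: (real^2) set). (1 - 0) \<bullet> b) = 1"
    by (intro prod.neutral) (auto simp: Basis_vec_def inner_axis)
  ultimately show "1 \<le> emeasure lborel fundamental_square" by simp
qed

lemma prob_space_torus_measure: "prob_space torus_measure"
  by (rule prob_spaceI) (simp add: emeasure_torus_measure emeasure_fundamental_square)

interpretation torus: prob_space torus_measure
  by (rule prob_space_torus_measure)

lemma emeasure_lborel_translate:
  fixes S :: "'a::euclidean_space set"
  assumes "S \<in> sets borel"
  shows "emeasure lborel ((\<lambda>x. x + v) -` S) = emeasure lborel S"
proof -
  have "lborel = distr lborel borel ((+) v)"
    by (rule lborel_distr_plus[symmetric])
  then have "emeasure lborel S = emeasure (distr lborel borel ((+) v)) S"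
    by simp
  also have "\<dots> = emeasure lborel ((\<lambda>x. x + v) -` S)"
    using assms by (simp add: emeasure_distr) (simp add: vimage_def add.commute)
  finally show ?thesis ..
qed

lemma axis_in_int_lattice: "axis i 1 \<in> int_lattice"
  by (simp add: int_lattice_def axis_def)

text \<open>Cut the fundamental square at height \<open>s\<close> in direction \<open>i\<close>.
  Translation carries one part of the square onto \<open>P2\<close>; the other part leaves the
  square and comes back onto \<open>P1\<close> after subtraction of a lattice vector. The preimage
  of \<open>B\<close> is invariant under that vector, so both parts keep their area.\<close>

lemma distr_torus_translate:
  assumes s: "0 \<le> s" "s < 1"
  shows "distr torus_measure borel (\<lambda>x. torus_translate x (s *\<^sub>R axis i 1)) = torus_measure"
proof (rule measure_eqI)
  fix B :: "torus set"
  assume "B \<in> sets (distr torus_measure borel (\<lambda>x. torus_translate x (s *\<^sub>R axis i 1)))"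
  then have [measurable]: "B \<in> sets borel" by simp
  let ?h = "s *\<^sub>R axis i 1 :: real^2" and ?e = "axis i 1 :: real^2"
  define E where "E = torus_of -` B"
  have [measurable]: "E \<in> sets borel"
    unfolding E_def
    using measurable_sets[OF borel_measurable_continuous_onI[OF continuous_torus_of], of B] by simp
  note [measurable] = fundamental_square_borel
  define P1 where "P1 = E \<inter> {x \<in> fundamental_square. x $ i < s}"
  define P2 where "P2 = E \<inter> {x \<in> fundamental_square. s \<le> x $ i}"
  have [measurable]: "P1 \<in> sets borel" "P2 \<in> sets borel"
    unfolding P1_def P2_def by measurable
  have per: "x - ?e \<in> E \<longleftrightarrow> x \<in> E" for x
  proof -
    have "torus_of (x - ?e) = torus_of x"
      using axis_in_int_lattice[of i] by (simp add: torus_of_eq_iff int_lattice_def)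
    then show ?thesis by (simp add: E_def)
  qed
  have m2: "(\<lambda>x. x + ?h) -` P2 \<in> sets borel"
    using measurable_sets[of "\<lambda>x. x + ?h" borel borel P2] by simp
  have m1: "(\<lambda>x. x + (?h - ?e)) -` P1 \<in> sets borel"
    using measurable_sets[of "\<lambda>x. x + (?h - ?e)" borel borel P1] by simp
  have split: "(\<lambda>x. x + ?h) -` E \<inter> fundamental_square
      = (\<lambda>x. x + ?h) -` P2 \<union> (\<lambda>x. x + (?h - ?e)) -` P1" (is "?L = ?R")
  proof (rule set_eqI)
    fix x
    have e: "x + (?h - ?e) \<in> E \<longleftrightarrow> x + ?h \<in> E"
      using per[of "x + ?h"] by (simp add: algebra_simps)
    have q: "x \<in> fundamental_square \<longleftrightarrow>
      (x + ?h \<in> fundamental_square \<and> s \<le> (x + ?h) $ i) \<or>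
      (x + (?h - ?e) \<in> fundamental_square \<and> (x + (?h - ?e)) $ i < s)"
      using s unfolding fundamental_square_def
      by (cases "i = 1") (auto simp: axis_def forall_2 exhaust_2)
    show "x \<in> ?L \<longleftrightarrow> x \<in> ?R"
      using e q unfolding P1_def P2_def by blast
  qed
  have disj: "(\<lambda>x. x + ?h) -` P2 \<inter> (\<lambda>x. x + (?h - ?e)) -` P1 = {}"
    by (auto simp: P1_def P2_def fundamental_square_def axis_def dest!: spec[of _ i])
  have "emeasure (distr torus_measure borel (\<lambda>x. torus_translate x ?h)) B
    = emeasure torus_measure ((\<lambda>x. torus_translate x ?h) -` B)"
    by (subst emeasure_distr) (simp_all add: measurable_cong_sets[OF sets_torus_measure refl])
  also have "\<dots> = emeasure lborel ((\<lambda>x. x + ?h) -` E \<inter> fundamental_square)"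
  proof (subst emeasure_torus_measure)
    show "(\<lambda>x. torus_translate x ?h) -` B \<in> sets borel"
      using measurable_sets[OF measurable_torus_translate, of B] by simp
  qed (simp add: E_def vimage_def torus_of_translate)
  also have "\<dots> = emeasure lborel P2 + emeasure lborel P1"
    unfolding split using disj m1 m2
    by (subst plus_emeasure[symmetric]) (simp_all add: emeasure_lborel_translate)
  also have "\<dots> = emeasure lborel (P2 \<union> P1)"
    by (subst plus_emeasure) (auto simp: P1_def P2_def)
  also have "P2 \<union> P1 = E \<inter> fundamental_square"
    by (auto simp: P1_def P2_def)
  finally show "emeasure (distr torus_measure borel (\<lambda>x. torus_translate x ?h)) B = emeasure torus_measure B"
    by (simp add: emeasure_torus_measure E_def)
qed simp

lemma integral_torus_translate:
  fixes f :: "torus \<Rightarrow> 'a::{banach, second_countable_topology}"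
  assumes "0 \<le> s" "s < 1" and [measurable]: "f \<in> borel_measurable borel"
  shows "(\<integral>x. f (torus_translate x (s *\<^sub>R axis i 1)) \<partial>torus_measure) = (\<integral>x. f x \<partial>torus_measure)"
  by (subst (2) distr_torus_translate[OF assms(1,2), of i, symmetric])
     (simp add: integral_distr measurable_cong_sets[OF sets_torus_measure refl])

lemma torus_character_of:
  "torus_character k (torus_of x) = cis (2 * pi * (\<Sum>i\<in>UNIV. of_int (k $ i) * x $ i))"
  by (simp add: torus_of.abs_eq torus_character.abs_eq)

lemma continuous_torus_character: "continuous_on UNIV (torus_character k)"
  by (rule continuous_on_torusI) (auto simp: torus_character_of intro!: continuous_intros)

lemma measurable_torus_character [measurable]: "torus_character k \<in> borel_measurable borel"
  by (rule borel_measurable_continuous_onI[OF continuous_torus_character])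

lemma norm_torus_character [simp]: "norm (torus_character k x) = 1"
  by (cases x rule: torus_of_cases) (simp add: torus_character_of)

lemma torus_character_0 [simp]: "torus_character 0 x = 1"
  by (cases x rule: torus_of_cases) (simp add: torus_character_of)

lemma torus_character_mult_cnj:
  "torus_character k x * cnj (torus_character l x) = torus_character (k - l) x"
  by (cases x rule: torus_of_cases)
     (simp add: torus_character_of cis_cnj cis_mult algebra_simps sum_subtractf)

lemma torus_character_translate:
  fixes s :: real
  shows "torus_character k (torus_translate x (s *\<^sub>R axis i 1)) = cis (2 * pi * (k $ i * s)) * torus_character k x"
proof (cases x rule: torus_of_cases)
  case (1 y)
  have "(\<Sum>j\<in>UNIV. real_of_int (k $ j) * (y + s *\<^sub>R axis i 1) $ j)
     = (\<Sum>j\<in>UNIV. real_of_int (k $ j) * y $ j) + k $ i * s"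
    by (simp add: algebra_simps sum.distrib axis_def if_distrib[of "\<lambda>x. _ * x"] cong: if_cong)
  then show ?thesis
    using 1 by (simp add: torus_character_of torus_of_translate cis_mult algebra_simps)
qed

text \<open>In a coordinate with \<open>k $ i \<noteq> 0\<close>, a shift by half a period changes
  the sign of the character but not its integral. The shift is at most 1/2 because
  \<open>k $ i\<close> is a nonzero integer.\<close>

lemma integral_torus_character:
  "(\<integral>x. torus_character k x \<partial>torus_measure) = (if k = 0 then 1 else 0)"
proof (cases "k = 0")
  case True
  then show ?thesis using torus.prob_space by simp
next
  case False
  then obtain i where i: "k $ i \<noteq> 0" by (auto simp: vec_eq_iff)
  define s where "s = 1 / (2 * \<bar>real_of_int (k $ i)\<bar>)"
  have "1 \<le> \<bar>real_of_int (k $ i)\<bar>" using i by linarith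
  then have s: "0 \<le> s" "s < 1" by (simp_all add: s_def field_simps)
  have "2 * pi * (k $ i * s) = pi \<or> 2 * pi * (k $ i * s) = - pi"
    using i by (cases "k $ i > 0") (auto simp: s_def field_simps)
  then have c: "cis (2 * pi * (k $ i * s)) = -1"
    by (elim disjE) (simp_all only: cis_pi cis_cnj[symmetric] complex_cnj_minus complex_cnj_one)
  have "(\<integral>x. torus_character k x \<partial>torus_measure) = - (\<integral>x. torus_character k x \<partial>torus_measure)"
    using integral_torus_translate[OF s measurable_torus_character, of k i]
    unfolding torus_character_translate c by simp
  then have "(\<integral>x. torus_character k x \<partial>torus_measure) = 0"
    by (simp add: eq_neg_iff_add_eq_0)
  then show ?thesis using False by simp
qed

lemma integrable_torus_bounded:
  fixes f :: "torus \<Rightarrow> 'a::{banach, second_countable_topology}"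
  assumes "f \<in> borel_measurable borel" "\<And>x. norm (f x) \<le> B"
  shows "integrable torus_measure f"
  using assms by (intro torus.integrable_const_bound[of _ B])
    (auto simp: measurable_cong_sets[OF sets_torus_measure refl])

section \<open>Fourier coefficients of Lipschitz functions\<close>

lemma borel_measurable_cnj [measurable (raw)]:
  "f \<in> borel_measurable M \<Longrightarrow> (\<lambda>x. cnj (f x)) \<in> borel_measurable M"
  by (rule borel_measurable_continuous_on[of cnj]) (auto intro: continuous_intros)

text \<open>Let \<open>S\<close> be the partial Fourier sum over \<open>K\<close>. Expanding the
  integral of |f - S|^2, orthonormality of the characters makes both cross terms and the term |S|^2
  equal to \<open>a\<close>, so what remains is the integral of |f|^2 minus \<open>a\<close>, which
  is nonnegative.\<close>

lemma torus_bessel: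
  assumes fm [measurable]: "f \<in> borel_measurable borel" and bd: "\<And>x. cmod (f x) \<le> B" and fin: "finite K"
  shows "(\<Sum>k\<in>K. (cmod (fourier_coeff f k))\<^sup>2) \<le> (\<integral>x. (cmod (f x))\<^sup>2 \<partial>torus_measure)"
proof -
  define S where "S x = (\<Sum>k\<in>K. fourier_coeff f k * torus_character k x)" for x
  define a where "a = (\<Sum>k\<in>K. (cmod (fourier_coeff f k))\<^sup>2)"
  have Sm [measurable]: "S \<in> borel_measurable borel" unfolding S_def by measurable
  have Sb: "cmod (S x) \<le> (\<Sum>k\<in>K. cmod (fourier_coeff f k))" for x
    unfolding S_def by (rule sum_norm_le) (simp add: norm_mult)
  have B: "0 \<le> B" using bd[of undefined] norm_ge_zero order_trans by blast
  define C where "C = (\<Sum>k\<in>K. cmod (fourier_coeff f k))"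
  have C: "0 \<le> C" unfolding C_def by (intro sum_nonneg) simp
  have int_ff: "integrable torus_measure (\<lambda>x. f x * cnj (f x))"
    by (rule integrable_torus_bounded[of _ "B * B"]) (auto simp: norm_mult intro!: mult_mono bd B)
  have int_fc: "integrable torus_measure (\<lambda>x. f x * cnj (torus_character k x))" for k
    by (rule integrable_torus_bounded[of _ B]) (auto simp: norm_mult bd)
  have int_fS: "integrable torus_measure (\<lambda>x. f x * cnj (S x))"
    by (rule integrable_torus_bounded[of _ "B * C"]) (auto simp: norm_mult C_def intro!: mult_mono bd B Sb)
  have int_SS: "integrable torus_measure (\<lambda>x. S x * cnj (S x))"
    by (rule integrable_torus_bounded[of _ "C * C"])
       (auto simp: norm_mult intro!: mult_mono C Sb[folded C_def])
  have fS: "(\<integral>x. f x * cnj (S x) \<partial>torus_measure) = of_real a"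
  proof -
    have "(\<integral>x. f x * cnj (S x) \<partial>torus_measure)
        = (\<integral>x. (\<Sum>k\<in>K. cnj (fourier_coeff f k) * (f x * cnj (torus_character k x))) \<partial>torus_measure)"
      by (simp add: S_def sum_distrib_left algebra_simps)
    also have "\<dots> = (\<Sum>k\<in>K. cnj (fourier_coeff f k) * fourier_coeff f k)"
      using int_fc by (simp add: fourier_coeff_def)
    also have "\<dots> = of_real a"
      by (simp only: a_def of_real_sum complex_norm_square mult.commute)
    finally show ?thesis .
  qed
  have SS: "(\<integral>x. S x * cnj (S x) \<partial>torus_measure) = of_real a"
  proof -
    have int_c: "integrable torus_measure (torus_character k)" for k
      by (rule integrable_torus_bounded[of _ 1]) auto
    have "(\<integral>x. S x * cnj (S x) \<partial>torus_measure)
        = (\<integral>x. (\<Sum>k\<in>K. \<Sum>l\<in>K. (fourier_coeff f k * cnj (fourier_coeff f l)) *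
               torus_character (k - l) x) \<partial>torus_measure)"
      by (simp add: S_def sum_product torus_character_mult_cnj[symmetric] algebra_simps)
    also have "\<dots> = (\<Sum>k\<in>K. \<Sum>l\<in>K. (fourier_coeff f k * cnj (fourier_coeff f l)) *
               (if k = l then 1 else 0))"
      using int_c by (simp add: integral_torus_character)
    also have "\<dots> = (\<Sum>k\<in>K. fourier_coeff f k * cnj (fourier_coeff f k))"
      using fin by (simp add: if_distrib[of "\<lambda>x. _ * x"] sum.delta cong: if_cong)
    also have "\<dots> = of_real a"
      by (simp only: a_def of_real_sum complex_norm_square)
    finally show ?thesis .
  qed
  have Sf: "(\<integral>x. S x * cnj (f x) \<partial>torus_measure) = of_real a"
  proof -
    have "(\<integral>x. S x * cnj (f x) \<partial>torus_measure) = cnj (\<integral>x. f x * cnj (S x) \<partial>torus_measure)"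
      by (subst Bochner_Integration.integral_cnj[symmetric]) (simp add: mult.commute)
    then show ?thesis by (simp add: fS)
  qed
  have int_Sf: "integrable torus_measure (\<lambda>x. S x * cnj (f x))"
    by (rule integrable_torus_bounded[of _ "C * B"]) (auto simp: norm_mult intro!: mult_mono bd B C Sb[folded C_def])
  have "(\<integral>x. of_real ((cmod (f x - S x))\<^sup>2) \<partial>torus_measure)
     = (\<integral>x. f x * cnj (f x) - f x * cnj (S x) - S x * cnj (f x) + S x * cnj (S x) \<partial>torus_measure)"
    by (simp only: complex_norm_square complex_cnj_diff) (simp add: algebra_simps)
  also have "\<dots> = (\<integral>x. f x * cnj (f x) \<partial>torus_measure) - of_real a"
    using int_ff int_fS int_Sf int_SS by (simp add: fS SS Sf)
  also have "(\<integral>x. f x * cnj (f x) \<partial>torus_measure) = (\<integral>x. of_real ((cmod (f x))\<^sup>2) \<partial>torus_measure)"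
    by (simp only: complex_norm_square)
  finally have "complex_of_real (\<integral>x. (cmod (f x - S x))\<^sup>2 \<partial>torus_measure) =
     of_real ((\<integral>x. (cmod (f x))\<^sup>2 \<partial>torus_measure) - a)"
    by (simp only: integral_complex_of_real of_real_diff)
  then have "(\<integral>x. (cmod (f x - S x))\<^sup>2 \<partial>torus_measure) = (\<integral>x. (cmod (f x))\<^sup>2 \<partial>torus_measure) - a"
    using of_real_eq_iff by blast
  moreover have "0 \<le> (\<integral>x. (cmod (f x - S x))\<^sup>2 \<partial>torus_measure)" by simp
  ultimately show ?thesis by (simp add: a_def)
qed

lemma fourier_coeff_translate:
  fixes s :: real
  assumes "0 \<le> s" "s < 1" and [measurable]: "f \<in> borel_measurable borel"
  shows "fourier_coeff (\<lambda>x. f (torus_translate x (s *\<^sub>R axis i 1))) k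
    = cis (2 * pi * (k $ i * s)) * fourier_coeff f k"
proof -
  let ?h = "s *\<^sub>R axis i 1 :: real^2" and ?c = "cis (2 * pi * (k $ i * s))"
  \<comment> \<open>Inserting \<open>?c * cnj ?c = 1\<close> makes the integrand a function of the
    translated point alone, ready for translation invariance.\<close>
  have "f (torus_translate x ?h) * cnj (torus_character k x)
      = ?c * (f (torus_translate x ?h) * cnj (torus_character k (torus_translate x ?h)))" for x
  proof -
    have "?c * cnj ?c = 1" by (simp add: cis_cnj cis_mult)
    then show ?thesis
      by (simp add: torus_character_translate mult.left_commute mult.assoc[symmetric])
  qed
  then have "fourier_coeff (\<lambda>x. f (torus_translate x ?h)) k
    = ?c * (\<integral>x. f (torus_translate x ?h) * cnj (torus_character k (torus_translate x ?h)) \<partial>torus_measure)"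
    unfolding fourier_coeff_def by (simp only: integral_mult_right_zero)
  also have "\<dots> = ?c * fourier_coeff f k"
    by (subst integral_torus_translate[OF assms(1,2)]) (auto simp: fourier_coeff_def)
  finally show ?thesis .
qed

lemma fourier_coeff_diff:
  assumes [measurable]: "f \<in> borel_measurable borel" and f: "\<And>x. cmod (f x) \<le> B"
    and [measurable]: "g \<in> borel_measurable borel" and g: "\<And>x. cmod (g x) \<le> C"
  shows "fourier_coeff (\<lambda>x. f x - g x) k = fourier_coeff f k - fourier_coeff g k"
proof -
  have "integrable torus_measure (\<lambda>x. f x * cnj (torus_character k x))"
    by (rule integrable_torus_bounded[of _ B]) (auto simp: norm_mult f)
  moreover have "integrable torus_measure (\<lambda>x. g x * cnj (torus_character k x))"
    by (rule integrable_torus_bounded[of _ C]) (auto simp: norm_mult g)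
  ultimately show ?thesis by (simp add: fourier_coeff_def left_diff_distrib)
qed

text \<open>|cis \<theta> - 1| = 2 |sin (\<theta>/2)|, so this is the derivative of the sine at 0.
  With c = 2 pi k_i it turns the phase of a translation into the Fourier multiplier of a partial
  derivative.\<close>

lemma tendsto_cis_difference_quotient:
  "((\<lambda>s. (cmod (cis (c * s) - 1))\<^sup>2 / s\<^sup>2) \<longlongrightarrow> c\<^sup>2) (at_right 0)"
proof -
  have sq: "(cmod (cis (c * s) - 1))\<^sup>2 = (2 * sin (c * s / 2))\<^sup>2" for s
  proof -
    have "(cmod (cis (c * s) - 1))\<^sup>2 = (cos (c * s) - 1)\<^sup>2 + (sin (c * s))\<^sup>2"
      by (simp add: cmod_power2)
    also have "\<dots> = 2 - 2 * cos (2 * (c * s / 2))"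
      using sin_cos_squared_add[of "c * s"] by (simp add: power2_diff)
    also have "\<dots> = (2 * sin (c * s / 2))\<^sup>2"
      by (simp only: cos_double_sin) (simp add: power_mult_distrib)
    finally show ?thesis .
  qed
  have "((\<lambda>s. sin (c * s / 2)) has_real_derivative c / 2) (at 0)"
    by (auto intro!: derivative_eq_intros)
  then have "((\<lambda>s. sin (c * s / 2) / s) \<longlongrightarrow> c / 2) (at_right 0)"
    by (auto simp: DERIV_def intro: tendsto_mono[OF at_le])
  then have "((\<lambda>s. (2 * (sin (c * s / 2) / s))\<^sup>2) \<longlongrightarrow> (2 * (c / 2))\<^sup>2) (at_right 0)"
    by (intro tendsto_power tendsto_mult tendsto_const)
  then show ?thesis
    by (simp add: sq power_mult_distrib power_divide)
qed

text \<open>Nikodym's difference-quotient argument on the Fourier side: Bessel's inequality is applied to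
  the increments of \<open>f\<close>, so no differentiability is needed.\<close>

lemma fourier_coeff_lipschitz:
  fixes f :: "torus \<Rightarrow> real"
  assumes [measurable]: "f \<in> borel_measurable borel" and bd: "\<And>x. \<bar>f x\<bar> \<le> 1"
    and [measurable]: "S \<in> sets borel" and supp: "\<And>x. x \<notin> S \<Longrightarrow> f x = 0"
    and meas: "measure torus_measure S \<le> m"
    and lip: "\<And>x s. 0 < s \<Longrightarrow> s < 1 \<Longrightarrow> \<bar>f (torus_translate x (s *\<^sub>R axis i 1)) - f x\<bar> \<le> L * s"
    and fin: "finite K"
  shows "(\<Sum>k\<in>K. (real_of_int (k $ i))\<^sup>2 * (cmod (fourier_coeff (\<lambda>x. of_real (f x)) k))\<^sup>2) \<le> 2 * L\<^sup>2 * m"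
proof -
  let ?F = "\<lambda>k. (cmod (fourier_coeff (\<lambda>x. of_real (f x)) k))\<^sup>2"
  have step: "(\<Sum>k\<in>K. (cmod (cis (2 * pi * k $ i * s) - 1))\<^sup>2 / s\<^sup>2 * ?F k) \<le> 2 * L\<^sup>2 * m"
    if s: "0 < s" "s < 1" for s
  proof -
    let ?T = "\<lambda>x. torus_translate x (s *\<^sub>R axis i 1)"
    let ?g = "\<lambda>x. complex_of_real (f (?T x)) - of_real (f x)"
    have "fourier_coeff ?g k = (cis (2 * pi * k $ i * s) - 1) * fourier_coeff (\<lambda>x. of_real (f x)) k" for k
      using s by (subst fourier_coeff_diff[where B=1 and C=1])
        (auto simp: bd algebra_simps fourier_coeff_translate[where f="\<lambda>x. complex_of_real (f x)"])
    then have "(\<Sum>k\<in>K. (cmod (cis (2 * pi * k $ i * s) - 1))\<^sup>2 * ?F k) = (\<Sum>k\<in>K. (cmod (fourier_coeff ?g k))\<^sup>2)"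
      by (simp add: norm_mult power_mult_distrib)
    also have "\<dots> \<le> (\<integral>x. (cmod (?g x))\<^sup>2 \<partial>torus_measure)"
    proof (rule torus_bessel[where B=2])
      show "cmod (?g x) \<le> 2" for x
        using norm_triangle_ineq4[of "complex_of_real (f (?T x))" "of_real (f x)"] bd[of x] bd[of "?T x"] by simp
    qed (use fin in auto)
    \<comment> \<open>The increment is at most \<open>L * s\<close> and vanishes unless
      \<open>x\<close> or its translate lies in \<open>S\<close>. Each of these two sets has measure
      at most \<open>m\<close>, which is the origin of the factor 2.\<close>
    also have "\<dots> \<le> (\<integral>x. (L * s)\<^sup>2 * (indicator S (?T x) + indicator S x) \<partial>torus_measure)"
    proof (rule integral_mono)
      have gb: "(cmod (?g x))\<^sup>2 \<le> (L * s)\<^sup>2" for x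
        using power_mono[OF lip[OF s, of x], of 2] norm_of_real[of "f (?T x) - f x", where 'a=complex]
        by (simp del: norm_of_real)
      show "(cmod (?g x))\<^sup>2 \<le> (L * s)\<^sup>2 * (indicator S (?T x) + indicator S x)" for x
        using gb[of x] supp[of x] supp[of "?T x"] by (auto simp: indicator_def intro: order_trans)
      show "integrable torus_measure (\<lambda>x. (cmod (?g x))\<^sup>2)"
        using gb by (intro integrable_torus_bounded[of _ "(L * s)\<^sup>2"]) auto
      show "integrable torus_measure (\<lambda>x. (L * s)\<^sup>2 * (indicator S (?T x) + indicator S x :: real))"
        by (intro integrable_torus_bounded[of _ "(L * s)\<^sup>2 * 2"])
           (auto simp: indicator_def abs_mult intro!: mult_left_mono)
    qed
    also have "\<dots> = (L * s)\<^sup>2 * (measure torus_measure S + measure torus_measure S)"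
    proof -
      have i1: "integrable torus_measure (\<lambda>x. indicator S x :: real)"
        by (rule integrable_torus_bounded[of _ 1]) (auto simp: indicator_def)
      have i2: "integrable torus_measure (\<lambda>x. indicator S (?T x) :: real)"
        by (rule integrable_torus_bounded[of _ 1]) (auto simp: indicator_def)
      show ?thesis
        using s i1 i2 integral_torus_translate[of s "\<lambda>x. indicator S x :: real" i] by simp
    qed
    also have "\<dots> \<le> (L * s)\<^sup>2 * (m + m)"
      by (intro mult_left_mono add_mono meas) simp
    finally have "(\<Sum>k\<in>K. (cmod (cis (2 * pi * k $ i * s) - 1))\<^sup>2 * ?F k) / s\<^sup>2 \<le> ((L * s)\<^sup>2 * (m + m)) / s\<^sup>2"
      by (rule divide_right_mono) simp
    also have "\<dots> = 2 * L\<^sup>2 * m"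
      using s by (simp add: power_mult_distrib field_simps)
    finally show ?thesis by (simp add: sum_divide_distrib)
  qed
  \<comment> \<open>The bound in \<open>step\<close> is uniform in \<open>s\<close> and
    \<open>K\<close> is finite, so the limit may be taken term by term.\<close>
  have "((\<lambda>s. \<Sum>k\<in>K. (cmod (cis (2 * pi * k $ i * s) - 1))\<^sup>2 / s\<^sup>2 * ?F k)
     \<longlongrightarrow> (\<Sum>k\<in>K. (2 * pi * k $ i)\<^sup>2 * ?F k)) (at_right 0)"
    by (intro tendsto_sum tendsto_mult tendsto_const tendsto_cis_difference_quotient)
  moreover have "\<forall>\<^sub>F s in at_right 0. (\<Sum>k\<in>K. (cmod (cis (2 * pi * k $ i * s) - 1))\<^sup>2 / s\<^sup>2 * ?F k) \<le> 2 * L\<^sup>2 * m"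
    using step by (auto simp: eventually_at_right[of 0 1] intro!: exI[of _ 1])
  ultimately have "(\<Sum>k\<in>K. (2 * pi * k $ i)\<^sup>2 * ?F k) \<le> 2 * L\<^sup>2 * m"
    by (rule tendsto_upperbound) simp
  moreover have "(\<Sum>k\<in>K. (real_of_int (k $ i))\<^sup>2 * ?F k) \<le> (\<Sum>k\<in>K. (2 * pi * k $ i)\<^sup>2 * ?F k)"
  proof (intro sum_mono mult_right_mono)
    have "1 \<le> (2 * pi)\<^sup>2" using pi_ge_two by (intro one_le_power) simp
    then show "(real_of_int (k $ i))\<^sup>2 \<le> (2 * pi * k $ i)\<^sup>2" for k
      using mult_right_mono[of 1 "(2 * pi)\<^sup>2" "(real_of_int (k $ i))\<^sup>2"] by (simp add: power_mult_distrib)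
  qed simp
  ultimately show ?thesis by simp
qed

text \<open>Interpolation between L^2 and H^1 with a free parameter \<open>a\<close>, which is later
  set to the length scale of the bump. The L^2 part contributes at most \<open>m\<close>, and each
  of the two coordinates contributes at most \<open>2 * L\<^sup>2 * m\<close>; together they form
  the factor \<open>1 + 4 * L\<^sup>2\<close>.\<close>

lemma sobolev_half_lipschitz_bound:
  fixes f :: "torus \<Rightarrow> real"
  assumes [measurable]: "f \<in> borel_measurable borel" and bd: "\<And>x. \<bar>f x\<bar> \<le> 1"
    and [measurable]: "S \<in> sets borel" and supp: "\<And>x. x \<notin> S \<Longrightarrow> f x = 0"
    and meas: "measure torus_measure S \<le> m"
    and lip: "\<And>x i s. 0 < s \<Longrightarrow> s < 1 \<Longrightarrow> \<bar>f (torus_translate x (s *\<^sub>R axis i 1)) - f x\<bar> \<le> L * s"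
    and fin: "finite K" and a: "0 < a"
  shows "(\<Sum>k\<in>K. (1 + (\<Sum>i\<in>UNIV. (real_of_int (k $ i))\<^sup>2)) powr (1/2) *
      (cmod (fourier_coeff (\<lambda>x. of_real (f x)) k))\<^sup>2) \<le> (m / a + a * m * (1 + 4 * L\<^sup>2)) / 2"
proof -
  let ?F = "\<lambda>k. (cmod (fourier_coeff (\<lambda>x. of_real (f x)) k))\<^sup>2"
  let ?w = "\<lambda>k::int^2. 1 + (\<Sum>i\<in>UNIV. (real_of_int (k $ i))\<^sup>2)"
  have L2: "(\<Sum>k\<in>K. ?F k) \<le> m"
  proof -
    have "(\<Sum>k\<in>K. ?F k) \<le> (\<integral>x. (cmod (of_real (f x)))\<^sup>2 \<partial>torus_measure)"
      using bd fin by (intro torus_bessel[where B=1]) auto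
    also have "\<dots> \<le> (\<integral>x. indicator S x \<partial>torus_measure)"
    proof (rule integral_mono)
      have "(f x)\<^sup>2 \<le> 1" for x using bd[of x] by (simp add: abs_square_le_1)
      then show "(cmod (of_real (f x)))\<^sup>2 \<le> indicator S x" for x
        using supp[of x] by (auto simp: indicator_def)
      show "integrable torus_measure (\<lambda>x. (cmod (of_real (f x)))\<^sup>2)"
        using \<open>\<And>x. (f x)\<^sup>2 \<le> 1\<close> by (intro integrable_torus_bounded[of _ 1]) auto
      show "integrable torus_measure (\<lambda>x. indicator S x :: real)"
        by (rule integrable_torus_bounded[of _ 1]) (auto simp: indicator_def)
    qed
    finally show ?thesis using meas by simp
  qed
  \<comment> \<open>The square root of the weight is the geometric mean of \<open>1 / a\<close> and
    \<open>a * ?w k\<close>, so the arithmetic-geometric inequality splits it into a constant and a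
    multiple of the H^1 weight.\<close>
  have w: "?w k powr (1/2) \<le> (1 / a + a * ?w k) / 2" for k
  proof -
    have w0: "0 \<le> ?w k" by (simp add: sum_nonneg add_nonneg_nonneg)
    have "sqrt (1 / a * (a * ?w k)) \<le> (1 / a + a * ?w k) / 2"
      using a w0 by (intro arith_geo_mean_sqrt) auto
    then show ?thesis using a w0 by (simp add: powr_half_sqrt)
  qed
  have "(\<Sum>k\<in>K. ?w k powr (1/2) * ?F k) \<le> (\<Sum>k\<in>K. (1 / a + a * ?w k) / 2 * ?F k)"
    by (intro sum_mono mult_right_mono w) simp
  also have "\<dots> = ((\<Sum>k\<in>K. ?F k) / a + a * ((\<Sum>k\<in>K. ?F k)
       + (\<Sum>k\<in>K. (real_of_int (k $ 1))\<^sup>2 * ?F k) + (\<Sum>k\<in>K. (real_of_int (k $ 2))\<^sup>2 * ?F k))) / 2"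
    by (simp add: sum_distrib_left sum_divide_distrib sum.distrib[symmetric] sum_2 UNIV_2 algebra_simps add_divide_distrib)
  also have "\<dots> \<le> (m / a + a * (m + 2 * L\<^sup>2 * m + 2 * L\<^sup>2 * m)) / 2"
    using a by (intro divide_right_mono add_mono mult_left_mono L2
      fourier_coeff_lipschitz[OF assms(1-5) lip fin]) auto
  also have "\<dots> = (m / a + a * m * (1 + 4 * L\<^sup>2)) / 2"
    by (simp add: algebra_simps)
  finally show ?thesis .
qed

section \<open>Balls on the torus\<close>

text \<open>This is the quotient distance between the classes of \<open>p\<close> and
  \<open>x\<close>. The centre stays in the plane, where the dense sequence is chosen; the proof
  obligation is invariance of the distance to the lattice under lattice shifts.\<close>

lift_definition torus_dist :: "real ^ 2 \<Rightarrow> torus \<Rightarrow> real" is "\<lambda>p x. infdist (x - p) int_lattice"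
proof -
  fix p x y :: "real ^ 2"
  assume "torus_rel x y"
  then have l: "x - y \<in> int_lattice" by (simp add: torus_rel_def)
  have le: "infdist (u - p) int_lattice \<le> infdist (v - p) int_lattice" if "u - v \<in> int_lattice" for u v
  proof -
    have ne: "int_lattice \<noteq> {}" by (auto simp: int_lattice_def intro!: exI[of _ 0])
    have "infdist (u - p) int_lattice \<le> dist (v - p) k" if k: "k \<in> int_lattice" for k
    proof -
      have "u - v + k \<in> int_lattice"
        using k \<open>u - v \<in> int_lattice\<close> by (simp add: int_lattice_def)
      moreover have "dist (u - p) (u - v + k) = dist (v - p) k"
        by (simp add: dist_norm algebra_simps)
      ultimately show ?thesis using infdist_le by metis
    qed
    then show ?thesis
      unfolding infdist_notempty[OF ne, of "v - p"] by (intro cINF_greatest ne)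
  qed
  have "- (x $ i - y $ i) \<in> \<int>" for i
    using l by (intro Ints_minus) (simp add: int_lattice_def)
  then have "y - x \<in> int_lattice" by (simp add: int_lattice_def)
  then show "infdist (x - p) int_lattice = infdist (y - p) int_lattice"
    using le l by (intro antisym) auto
qed

lemma torus_dist_of: "torus_dist p (torus_of x) = infdist (x - p) int_lattice"
  by (simp add: torus_of.abs_eq torus_dist.abs_eq)

lemma torus_dist_self: "torus_dist p (torus_of p) = 0"
  by (simp add: torus_dist_of int_lattice_def)

lemma torus_dist_translate: "\<bar>torus_dist p (torus_translate x v) - torus_dist p x\<bar> \<le> norm v"
proof (cases x rule: torus_of_cases)
  case (1 y)
  then show ?thesis
    using infdist_triangle_abs[of "y + v - p" int_lattice "y - p"]
    by (simp add: torus_of_translate torus_dist_of dist_norm)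
qed

text \<open>The infimum over the lattice is below \<rho>, so some lattice vector is within \<rho>.
  Passing to coordinates replaces a disc by its enclosing square, which reduces the area and time
  estimates to counting integers.\<close>

lemma torus_dist_lessD:
  assumes "torus_dist p (torus_of x) < \<rho>"
  shows "\<exists>k. \<forall>i. \<bar>x $ i - p $ i - of_int (k i)\<bar> < \<rho>"
proof -
  have ne: "int_lattice \<noteq> {}" by (auto simp: int_lattice_def intro!: exI[of _ 0])
  have "(INF a\<in>int_lattice. dist (x - p) a) < \<rho>"
    using assms by (simp add: torus_dist_of infdist_notempty[OF ne])
  then obtain v where v: "v \<in> int_lattice" "dist (x - p) v < \<rho>"
    using ne by (subst (asm) cINF_less_iff) (auto intro!: bdd_belowI2[of _ 0])
  have "\<forall>i. \<exists>k. v $ i = of_int k" using v(1) by (auto simp: int_lattice_def elim: Ints_cases)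
  then obtain k where k: "\<And>i. v $ i = of_int (k i)" by metis
  have "\<bar>x $ i - p $ i - of_int (k i)\<bar> < \<rho>" for i
    using component_le_norm_cart[of "x - p - v" i] v(2) by (simp add: k dist_norm)
  then show ?thesis by blast
qed

lemma continuous_torus_dist: "continuous_on UNIV (torus_dist p)"
  by (rule continuous_on_torusI) (auto simp: torus_dist_of intro!: continuous_intros)

lemma open_torus_ball: "open {x. torus_dist p x < \<rho>}"
  using continuous_torus_dist by (intro open_Collect_less) auto

lemma borel_torus_ball [measurable]: "{x. torus_dist p x < \<rho>} \<in> sets borel"
  by (simp add: open_torus_ball)

lemma measurable_torus_line [measurable]: "(\<lambda>t. torus_translate x (t *\<^sub>R \<nu>)) \<in> borel_measurable borel"
proof (cases x rule: torus_of_cases)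
  case (1 y)
  have "continuous_on UNIV (\<lambda>t. torus_of (y + t *\<^sub>R \<nu>))"
    by (rule continuous_on_compose2[OF continuous_torus_of]) (auto intro!: continuous_intros)
  then show ?thesis
    by (simp add: 1 torus_of_translate borel_measurable_continuous_onI)
qed

text \<open>In the fundamental square the ball is covered by squares of side \<open>2 * r\<close>
  around lattice translates of \<open>p\<close>. With \<open>r \<le> 1/2\<close>, three integers per
  coordinate suffice, giving the area 9 (2 r)^2.\<close>

lemma measure_torus_ball_le:
  assumes r: "0 < r" "r \<le> 1/2"
  shows "measure torus_measure {x. torus_dist p x < r} \<le> 36 * r\<^sup>2"
proof -
  define m where "m i = \<lfloor>- p $ i - 1/2\<rfloor>" for i
  define B where "B = (\<lambda>(k::int, l::int). cbox (vector [p $ 1 + k - r, p $ 2 + l - r])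
     (vector [p $ 1 + k + r, p $ 2 + l + r] :: real^2))"
  let ?I = "{m 1..m 1 + 2} \<times> {m 2..m 2 + 2}"
  have "torus_of -` {x. torus_dist p x < r} \<inter> fundamental_square \<subseteq> (\<Union>z\<in>?I. B z)"
  proof
    fix x assume x: "x \<in> torus_of -` {x. torus_dist p x < r} \<inter> fundamental_square"
    then obtain k where k: "\<And>i. \<bar>x $ i - p $ i - of_int (k i)\<bar> < r"
      using torus_dist_lessD by blast
    have "k i \<in> {m i..m i + 2}" for i
    proof -
      have "0 \<le> x $ i" "x $ i < 1" using x by (auto simp: fundamental_square_def)
      then show ?thesis using k[of i] r unfolding m_def by auto linarith+
    qed
    then have "(k 1, k 2) \<in> ?I" by blast
    moreover have "x \<in> B (k 1, k 2)"
      using k[of 1] k[of 2] by (auto simp: B_def mem_box_cart forall_2)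
    ultimately show "x \<in> (\<Union>z\<in>?I. B z)" by blast
  qed
  then have "emeasure lborel (torus_of -` {x. torus_dist p x < r} \<inter> fundamental_square)
     \<le> emeasure lborel (\<Union>z\<in>?I. B z)"
    by (intro emeasure_mono) (auto simp: B_def)
  also have "\<dots> \<le> (\<Sum>z\<in>?I. emeasure lborel (B z))"
    by (intro emeasure_subadditive_finite) (auto simp: B_def)
  also have "\<dots> = (\<Sum>z\<in>?I. ennreal ((2 * r)\<^sup>2))"
  proof (intro sum.cong refl)
    fix z :: "int \<times> int"
    obtain k l where z: "z = (k, l)" by (cases z)
    have "measure lborel (B z) = (2 * r)\<^sup>2"
      using r unfolding z B_def
      by (simp, subst content_cbox_cart) (simp_all add: interval_ne_empty_cart forall_2 UNIV_2 power2_eq_square)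
    then show "emeasure lborel (B z) = ennreal ((2 * r)\<^sup>2)"
      by (simp add: z B_def emeasure_eq_measure2[OF fmeasurable_cbox])
  qed
  also have "\<dots> = ennreal (36 * r\<^sup>2)"
    by (simp add: ennreal_mult'[symmetric] ennreal_numeral[symmetric] del: ennreal_numeral)
  finally show ?thesis
    by (simp add: emeasure_torus_measure measure_def enn2real_leI)
qed

text \<open>A unit vector has a coordinate of modulus at least 1/2. Watching that coordinate alone,
  the line stays within \<open>r\<close> of a given integer translate during an interval of length
  at most \<open>4 * r\<close>, and four translates cover all that can be met in unit time. The
  bound is therefore uniform in the base point, the direction and the centre.\<close>

lemma measure_line_torus_ball_le:
  assumes r: "0 < r" "r \<le> 1/2" and \<nu>: "norm \<nu> = 1"
  shows "measure lborel {t \<in> {0<..<1}. torus_dist p (torus_translate x (t *\<^sub>R \<nu>)) < r} \<le> 16 * r"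
proof -
  obtain y where y: "x = torus_of y" by (cases x rule: torus_of_cases)
  have "\<exists>i. 1/2 \<le> \<bar>\<nu> $ i\<bar>"
  proof (rule ccontr)
    assume "\<not> ?thesis"
    then have "\<bar>\<nu> $ i\<bar> \<le> 1/2" for i by (auto simp: not_le less_imp_le)
    then have "(\<nu> $ i)\<^sup>2 \<le> (1/2)\<^sup>2" for i using power_mono[of "\<bar>\<nu> $ i\<bar>" "1/2" 2] by simp
    from this[of 1] this[of 2] have "(norm \<nu>)\<^sup>2 \<le> 1/2"
      by (simp add: norm_vec_def L2_set_def sum_2 power2_eq_square)
    then show False using \<nu> by simp
  qed
  then obtain i where i: "1/2 \<le> \<bar>\<nu> $ i\<bar>" ..
  have i1: "\<bar>\<nu> $ i\<bar> \<le> 1" using component_le_norm_cart[of \<nu> i] \<nu> by simp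
  define a where "a = y $ i - p $ i"
  \<comment> \<open>The coordinate moves by at most 1 and the ball adds at most 1/2, so the relevant
    integers lie within 3/2 of \<open>a\<close>, hence in \<open>{m..m+3}\<close>.\<close>
  define m where "m = \<lfloor>a - 3/2\<rfloor>"
  define J where "J n = {(of_int n - a) / \<nu> $ i - 2 * r .. (of_int n - a) / \<nu> $ i + 2 * r}" for n :: int
  have meas: "{t \<in> {0<..<1}. torus_dist p (torus_translate x (t *\<^sub>R \<nu>)) < r} \<in> sets borel"
    using measurable_sets[OF measurable_torus_line borel_torus_ball, of x \<nu> p r]
    by (simp add: Collect_conj_eq vimage_def)
  have "{t \<in> {0<..<1}. torus_dist p (torus_translate x (t *\<^sub>R \<nu>)) < r} \<subseteq> (\<Union>n\<in>{m..m+3}. J n)"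
  proof clarsimp
    fix t :: real assume t: "0 < t" "t < 1" and "torus_dist p (torus_translate x (t *\<^sub>R \<nu>)) < r"
    then obtain k where "\<And>i. \<bar>(y + t *\<^sub>R \<nu>) $ i - p $ i - of_int (k i)\<bar> < r"
      unfolding y torus_of_translate using torus_dist_lessD by blast
    from this[of i] have k: "\<bar>a + t * \<nu> $ i - of_int (k i)\<bar> < r"
      by (simp add: a_def algebra_simps)
    have "\<bar>t * \<nu> $ i\<bar> \<le> 1"
      using t i1 mult_mono[of t 1 "\<bar>\<nu> $ i\<bar>" 1] by (simp add: abs_mult)
    then have "k i \<in> {m..m+3}"
      using k r unfolding m_def by auto linarith+
    moreover have "t \<in> J (k i)"
    proof -
      have nz: "\<nu> $ i \<noteq> 0" using i by auto
      have "\<bar>t - (of_int (k i) - a) / \<nu> $ i\<bar> * \<bar>\<nu> $ i\<bar> = \<bar>a + t * \<nu> $ i - of_int (k i)\<bar>"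
        using nz by (simp add: abs_mult[symmetric] field_simps)
      also have "\<dots> \<le> 2 * r * (1/2)" using k by simp
      also have "\<dots> \<le> 2 * r * \<bar>\<nu> $ i\<bar>" using i r by (intro mult_left_mono) auto
      finally have "\<bar>t - (of_int (k i) - a) / \<nu> $ i\<bar> \<le> 2 * r"
        using nz by simp
      then show ?thesis by (auto simp: J_def abs_le_iff)
    qed
    ultimately show "\<exists>n\<in>{m..m+3}. t \<in> J n" by blast
  qed
  then have "measure lborel {t \<in> {0<..<1}. torus_dist p (torus_translate x (t *\<^sub>R \<nu>)) < r}
      \<le> measure lborel (\<Union>n\<in>{m..m+3}. J n)"
    using meas by (intro measure_mono_fmeasurable fmeasurable.finite_UN)
      (auto simp: J_def emeasure_lborel_Icc_eq intro!: fmeasurableI)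
  also have "\<dots> \<le> (\<Sum>n\<in>{m..m+3}. measure lborel (J n))"
    by (intro measure_UNION_le) (auto simp: J_def)
  also have "\<dots> = 16 * r" using r by (simp add: J_def)
  finally show ?thesis .
qed

section \<open>Cutoffs at a sequence of points\<close>

definition torus_bump :: "real ^ 2 \<Rightarrow> real \<Rightarrow> torus \<Rightarrow> real" where
  "torus_bump p r x = max 0 (min 1 (2 - torus_dist p x / r))"

lemma torus_bump_bounds: "0 \<le> torus_bump p r x" "torus_bump p r x \<le> 1"
  by (simp_all add: torus_bump_def)

lemma torus_bump_eq_1: "0 < r \<Longrightarrow> torus_dist p x < r \<Longrightarrow> torus_bump p r x = 1"
  by (simp add: torus_bump_def field_simps)

lemma torus_bump_eq_0: "0 < r \<Longrightarrow> \<not> torus_dist p x < 2 * r \<Longrightarrow> torus_bump p r x = 0"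
  by (simp add: torus_bump_def field_simps)

lemma torus_bump_translate:
  assumes "0 < r"
  shows "\<bar>torus_bump p r (torus_translate x v) - torus_bump p r x\<bar> \<le> norm v / r"
proof -
  have "\<bar>torus_bump p r (torus_translate x v) - torus_bump p r x\<bar>
      \<le> \<bar>torus_dist p (torus_translate x v) / r - torus_dist p x / r\<bar>"
    unfolding torus_bump_def by (auto simp: max_def min_def)
  also have "\<dots> = \<bar>torus_dist p (torus_translate x v) - torus_dist p x\<bar> / r"
    using assms by (simp add: diff_divide_distrib[symmetric] abs_divide)
  also have "\<dots> \<le> norm v / r"
    using assms by (intro divide_right_mono torus_dist_translate) auto
  finally show ?thesis .
qed

lemma measurable_torus_bump [measurable]: "torus_bump p r \<in> borel_measurable borel"
proof -
  have [measurable]: "torus_dist p \<in> borel_measurable borel"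
    by (rule borel_measurable_continuous_onI[OF continuous_torus_dist])
  show ?thesis unfolding torus_bump_def by measurable
qed

primrec torus_cutoff :: "(nat \<Rightarrow> real ^ 2) \<Rightarrow> (nat \<Rightarrow> real) \<Rightarrow> nat \<Rightarrow> torus \<Rightarrow> real" where
  "torus_cutoff p r 0 = (\<lambda>x. 1)"
| "torus_cutoff p r (Suc n) = (\<lambda>x. min (torus_cutoff p r n x) (1 - torus_bump (p n) (r n) x))"

lemma torus_cutoff_bounds: "0 \<le> torus_cutoff p r n x" "torus_cutoff p r n x \<le> 1"
  by (induction n) (auto simp: torus_bump_bounds intro: min.coboundedI1)

lemma measurable_torus_cutoff [measurable]: "torus_cutoff p r n \<in> borel_measurable borel"
  by (induction n) simp_all

text \<open>A minimum of functions with a common Lipschitz constant keeps that constant. The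
  smallest radius alone governs the bound, however many bumps overlap; a sum or a product of cutoffs
  would accumulate constants.\<close>

lemma torus_cutoff_translate:
  assumes "0 < \<rho>" "\<And>j. j < n \<Longrightarrow> \<rho> \<le> r j"
  shows "\<bar>torus_cutoff p r n (torus_translate x v) - torus_cutoff p r n x\<bar> \<le> norm v / \<rho>"
  using assms(2)
proof (induction n)
  case 0
  then show ?case using assms(1) by simp
next
  case (Suc n)
  have "0 < r n" using Suc.prems[of n] assms(1) by linarith
  then have "\<bar>torus_bump (p n) (r n) (torus_translate x v) - torus_bump (p n) (r n) x\<bar> \<le> norm v / r n"
    by (rule torus_bump_translate)
  also have "\<dots> \<le> norm v / \<rho>"
    using Suc.prems[of n] assms(1) by (intro divide_left_mono) auto
  finally have "\<bar>torus_bump (p n) (r n) (torus_translate x v) - torus_bump (p n) (r n) x\<bar> \<le> norm v / \<rho>" .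
  moreover have "\<bar>torus_cutoff p r n (torus_translate x v) - torus_cutoff p r n x\<bar> \<le> norm v / \<rho>"
    using Suc by simp
  ultimately show ?case by (auto simp: min_def)
qed

lemma decseq_torus_cutoff: "decseq (\<lambda>n. torus_cutoff p r n x)"
  by (rule decseq_SucI) simp

definition torus_gamma :: "(nat \<Rightarrow> real ^ 2) \<Rightarrow> (nat \<Rightarrow> real) \<Rightarrow> torus \<Rightarrow> real" where
  "torus_gamma p r x = (INF n. torus_cutoff p r n x)"

lemma torus_cutoff_tendsto: "(\<lambda>n. torus_cutoff p r n x) \<longlonglongrightarrow> torus_gamma p r x"
  unfolding torus_gamma_def
  by (intro LIMSEQ_decseq_INF decseq_torus_cutoff bdd_belowI2[of _ 0] torus_cutoff_bounds)

lemma torus_gamma_bounds: "0 \<le> torus_gamma p r x" "torus_gamma p r x \<le> 1"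
  using torus_cutoff_bounds[of p r _ x]
  by (auto intro: LIMSEQ_le_const[OF torus_cutoff_tendsto] LIMSEQ_le_const2[OF torus_cutoff_tendsto])

lemma measurable_torus_gamma [measurable]: "torus_gamma p r \<in> borel_measurable borel"
  by (rule borel_measurable_LIMSEQ_real[OF torus_cutoff_tendsto]) simp

lemma torus_gamma_eq_0:
  assumes "torus_bump (p n) (r n) x = 1"
  shows "torus_gamma p r x = 0"
proof -
  have "torus_gamma p r x \<le> torus_cutoff p r (Suc n) x"
    by (rule decseq_ge[OF decseq_torus_cutoff torus_cutoff_tendsto])
  then show ?thesis using assms torus_gamma_bounds[of p r x] torus_cutoff_bounds[of p r n x] by simp
qed

lemma torus_gamma_eq_1:
  assumes "\<And>n. torus_bump (p n) (r n) x = 0"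
  shows "torus_gamma p r x = 1"
proof -
  have "torus_cutoff p r n x = 1" for n by (induction n) (simp_all add: assms)
  then show ?thesis by (simp add: torus_gamma_def)
qed

section \<open>Uniform H^(1/2) bounds and passage to the limit\<close>

definition sobolev_half_norm :: "(int ^ 2) set \<Rightarrow> (torus \<Rightarrow> real) \<Rightarrow> real" where
  "sobolev_half_norm K f = sqrt (\<Sum>k\<in>K. (1 + (\<Sum>i\<in>UNIV. (real_of_int (k $ i))\<^sup>2)) powr (1/2) *
      (cmod (fourier_coeff (\<lambda>x. of_real (f x)) k))\<^sup>2)"

text \<open>Moving the weight inside the square halves its exponent. In this form the norm inherits
  Minkowski's inequality from \<open>L2_set\<close>.\<close>

lemma sobolev_half_norm_L2_set:
  "sobolev_half_norm K f = L2_set (\<lambda>k. (1 + (\<Sum>i\<in>UNIV. (real_of_int (k $ i))\<^sup>2)) powr (1/4) *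
      cmod (fourier_coeff (\<lambda>x. of_real (f x)) k)) K"
  by (simp add: sobolev_half_norm_def L2_set_def power_mult_distrib power2_eq_square[of "_ powr _"]
    powr_add[symmetric])

lemma sobolev_half_norm_le_diff:
  assumes [measurable]: "f \<in> borel_measurable borel" "g \<in> borel_measurable borel"
    and "\<And>x. \<bar>f x\<bar> \<le> B" "\<And>x. \<bar>g x\<bar> \<le> C"
  shows "sobolev_half_norm K g \<le> sobolev_half_norm K f + sobolev_half_norm K (\<lambda>x. f x - g x)"
proof -
  let ?w = "\<lambda>k::int^2. (1 + (\<Sum>i\<in>UNIV. (real_of_int (k $ i))\<^sup>2)) powr (1/4)"
  let ?c = "\<lambda>f k. fourier_coeff (\<lambda>x. complex_of_real (f x)) k"
  have "?c (\<lambda>x. f x - g x) k = ?c f k - ?c g k" for k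
    using fourier_coeff_diff[of "\<lambda>x. complex_of_real (f x)" B "\<lambda>x. complex_of_real (g x)" C k] assms by simp
  then have "cmod (?c g k) \<le> cmod (?c f k) + cmod (?c (\<lambda>x. f x - g x) k)" for k
    using norm_triangle_ineq4[of "?c f k" "?c f k - ?c g k"] by simp
  then have "?w k * cmod (?c g k) \<le> ?w k * cmod (?c f k) + ?w k * cmod (?c (\<lambda>x. f x - g x) k)" for k
    by (simp add: distrib_left[symmetric] mult_left_mono)
  then have "sobolev_half_norm K g \<le>
     L2_set (\<lambda>k. ?w k * cmod (?c f k) + ?w k * cmod (?c (\<lambda>x. f x - g x) k)) K"
    unfolding sobolev_half_norm_L2_set by (intro L2_set_mono) auto
  also have "\<dots> \<le> sobolev_half_norm K f + sobolev_half_norm K (\<lambda>x. f x - g x)"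
    unfolding sobolev_half_norm_L2_set by (rule L2_set_triangle_ineq)
  finally show ?thesis .
qed

text \<open>A Fatou argument on the Fourier side: dominated convergence gives convergence of every
  coefficient, each finite weighted sum inherits the bound \<open>C\<^sup>2\<close>, and nonnegative
  terms with bounded finite sums are summable.\<close>

lemma sobolev_half_limit:
  fixes g :: "nat \<Rightarrow> torus \<Rightarrow> real"
  assumes [measurable]: "\<And>n. g n \<in> borel_measurable borel" and bd: "\<And>n x. \<bar>g n x\<bar> \<le> B"
    and lim: "\<And>x. (\<lambda>n. g n x) \<longlonglongrightarrow> f x"
    and sob: "\<And>n K. finite K \<Longrightarrow> sobolev_half_norm K (g n) \<le> C"
  shows "(\<lambda>x. of_real (f x)) \<in> sobolev_torus (1/2)"
proof -
  have fm [measurable]: "f \<in> borel_measurable borel"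
    by (rule borel_measurable_LIMSEQ_real[OF lim]) simp
  have fb: "\<bar>f x\<bar> \<le> B" for x
    using bd by (intro LIMSEQ_le_const2[OF tendsto_rabs[OF lim]]) auto
  let ?c = "\<lambda>f k. fourier_coeff (\<lambda>x. complex_of_real (f x)) k"
  have coeff: "(\<lambda>n. ?c (g n) k) \<longlonglongrightarrow> ?c f k" for k
    unfolding fourier_coeff_def
  proof (rule integral_dominated_convergence[where w="\<lambda>x. B"])
    show "AE x in torus_measure. (\<lambda>n. complex_of_real (g n x) * cnj (torus_character k x))
       \<longlonglongrightarrow> complex_of_real (f x) * cnj (torus_character k x)"
      by (intro AE_I2 tendsto_intros lim)
  qed (auto simp: norm_mult bd measurable_cong_sets[OF sets_torus_measure refl])
  let ?w = "\<lambda>k::int^2. (1 + (\<Sum>i\<in>UNIV. (real_of_int (k $ i))\<^sup>2)) powr (1/2)"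
  have "(\<Sum>k\<in>K. ?w k * (cmod (?c f k))\<^sup>2) \<le> C\<^sup>2" if "finite K" for K
  proof (rule LIMSEQ_le_const2)
    show "(\<lambda>n. \<Sum>k\<in>K. ?w k * (cmod (?c (g n) k))\<^sup>2) \<longlonglongrightarrow> (\<Sum>k\<in>K. ?w k * (cmod (?c f k))\<^sup>2)"
      by (intro tendsto_intros coeff)
    have "(\<Sum>k\<in>K. ?w k * (cmod (?c (g n) k))\<^sup>2) \<le> C\<^sup>2" for n
      using sob[OF that, of n] unfolding sobolev_half_norm_def by (rule sqrt_le_D)
    then show "\<exists>N. \<forall>n\<ge>N. (\<Sum>k\<in>K. ?w k * (cmod (?c (g n) k))\<^sup>2) \<le> C\<^sup>2" by blast
  qed
  then have "(\<lambda>k. ?w k * (cmod (?c f k))\<^sup>2) summable_on UNIV"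
    by (intro nonneg_bdd_above_summable_on) (auto intro!: bdd_aboveI2[of _ _ "C\<^sup>2"])
  moreover have "integrable torus_measure (\<lambda>x. (cmod (of_real (f x)))\<^sup>2)"
    using power_mono[OF fb abs_ge_zero, of _ 2]
    by (intro integrable_torus_bounded[of _ "B\<^sup>2"]) auto
  ultimately show ?thesis
    by (simp add: sobolev_torus_def L2_torus_def measurable_cong_sets[OF sets_torus_measure refl])
qed

text \<open>The constant function has Lipschitz constant 0, so the interpolation bound with
  \<open>m = a = 1\<close> gives exactly 1.\<close>

lemma sobolev_half_norm_1:
  assumes "finite K"
  shows "sobolev_half_norm K (\<lambda>x. 1) \<le> 1"
proof -
  have "(\<Sum>k\<in>K. (1 + (\<Sum>i\<in>UNIV. (real_of_int (k $ i))\<^sup>2)) powr (1/2) *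
      (cmod (fourier_coeff (\<lambda>x. of_real 1) k))\<^sup>2) \<le> (1 / 1 + 1 * 1 * (1 + 4 * 0\<^sup>2)) / 2"
    using assms by (intro sobolev_half_lipschitz_bound[where S=UNIV]) auto
  then show ?thesis unfolding sobolev_half_norm_def by simp
qed

lemma sobolev_half_norm_torus_cutoff_step:
  assumes r: "\<And>n. 0 < r n" "\<And>n. r n \<le> 1/4" "decseq r" and K: "finite K"
  shows "sobolev_half_norm K (\<lambda>x. torus_cutoff p r n x - torus_cutoff p r (Suc n) x) \<le> 36 * sqrt (r n)"
proof -
  let ?f = "\<lambda>x. torus_cutoff p r n x - torus_cutoff p r (Suc n) x"
  have "(\<Sum>k\<in>K. (1 + (\<Sum>i\<in>UNIV. (real_of_int (k $ i))\<^sup>2)) powr (1/2) *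
      (cmod (fourier_coeff (\<lambda>x. of_real (?f x)) k))\<^sup>2)
    \<le> ((144 * (r n)\<^sup>2) / r n + r n * (144 * (r n)\<^sup>2) * (1 + 4 * (2 / r n)\<^sup>2)) / 2"
  proof (rule sobolev_half_lipschitz_bound[where S="{x. torus_dist (p n) x < 2 * r n}"])
    show "\<bar>?f x\<bar> \<le> 1" for x
      using torus_cutoff_bounds[of p r n x] torus_cutoff_bounds[of p r "Suc n" x] by linarith
    \<comment> \<open>Outside the outer ball the new competitor in the minimum is 1, so the cutoff
      does not change there.\<close>
    show "?f x = 0" if "x \<notin> {x. torus_dist (p n) x < 2 * r n}" for x
      using that r(1)[of n] torus_cutoff_bounds[of p r n x] by (simp add: torus_bump_eq_0)
    show "measure torus_measure {x. torus_dist (p n) x < 2 * r n} \<le> 144 * (r n)\<^sup>2"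
      using measure_torus_ball_le[of "2 * r n" "p n"] r(1,2)[of n] by (simp add: power_mult_distrib)
    show "\<bar>?f (torus_translate x (s *\<^sub>R axis i 1)) - ?f x\<bar> \<le> 2 / r n * s" if "0 < s" "s < 1" for x i s
    proof -
      have "\<bar>torus_cutoff p r m (torus_translate x (s *\<^sub>R axis i 1)) - torus_cutoff p r m x\<bar> \<le> s / r n"
        if "m \<le> Suc n" for m
        using torus_cutoff_translate[of "r n" m r p x "s *\<^sub>R axis i 1"] r(1)[of n] \<open>0 < s\<close> that
          decseqD[OF r(3)] by (simp add: less_Suc_eq_le)
      from this[of n] this[of "Suc n"] show ?thesis by (simp del: torus_cutoff.simps)
    qed
  qed (use K r(1)[of n] in auto)
  also have "\<dots> = 1224 * r n + 72 * r n * (r n)\<^sup>2"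
    using r(1)[of n] by (simp add: field_simps power2_eq_square)
  also have "\<dots> \<le> 1224 * r n + 72 * r n * 1"
    using r(1)[of n] r(2)[of n] by (intro add_left_mono mult_left_mono power_le_one) auto
  also have "\<dots> = 36\<^sup>2 * r n" by simp
  finally show ?thesis
    unfolding sobolev_half_norm_def using real_sqrt_le_mono by (fastforce simp: real_sqrt_mult)
qed

lemma torus_gamma_sobolev:
  assumes r: "\<And>n. r n = (1/4) ^ (n + 4)"
  shows "(\<lambda>x. of_real (torus_gamma p r x)) \<in> sobolev_torus (1/2)"
proof (rule sobolev_half_limit[OF measurable_torus_cutoff _ torus_cutoff_tendsto])
  show "\<bar>torus_cutoff p r n x\<bar> \<le> 1" for n x
    using torus_cutoff_bounds[of p r n x] by simp
  show "sobolev_half_norm K (torus_cutoff p r n) \<le> 6" if K: "finite K" for n K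
  proof -
    \<comment> \<open>The n-th step adds at most 36/16 = 9/4 times 2^-n, while the bound
      \<open>6 - 5 * (1/2) ^ n\<close> grows by 5/2 times 2^-n; at \<open>n = 0\<close> it equals 1,
      the bound for the constant function.\<close>
    have "sobolev_half_norm K (torus_cutoff p r n) \<le> 6 - 5 * (1/2) ^ n"
    proof (induction n)
      case 0
      then show ?case using sobolev_half_norm_1[OF K] by simp
    next
      case (Suc n)
      have rpos: "0 < r n" for n by (simp add: r)
      have rle: "r n \<le> 1/4" for n
        using power_decreasing[of 1 "n + 4" "1/4::real"] by (simp add: r)
      have rdec: "decseq r" by (auto simp: r decseq_def intro!: power_decreasing)
      have "sqrt (r n) = (1/2) ^ (n + 4)"
        by (rule real_sqrt_unique) (simp_all only: r power2_eq_square power_mult_distrib[symmetric], simp_all)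
      then have "sobolev_half_norm K (\<lambda>x. torus_cutoff p r n x - torus_cutoff p r (Suc n) x) \<le> 36 * (1/2) ^ (n + 4)"
        using sobolev_half_norm_torus_cutoff_step[OF rpos rle rdec K, of p n] by simp
      moreover have "sobolev_half_norm K (torus_cutoff p r (Suc n)) \<le> sobolev_half_norm K (torus_cutoff p r n)
         + sobolev_half_norm K (\<lambda>x. torus_cutoff p r n x - torus_cutoff p r (Suc n) x)"
      proof (rule sobolev_half_norm_le_diff[where B=1 and C=1])
        show "\<bar>torus_cutoff p r m x\<bar> \<le> 1" for m x
          using torus_cutoff_bounds[of p r m x] by simp
        then show "\<bar>torus_cutoff p r m x\<bar> \<le> 1" for m x .
      qed (rule measurable_torus_cutoff)+
      moreover have "(1/2::real) ^ (n + 4) = (1/2) ^ n / 16" "(1/2::real) ^ Suc n = (1/2) ^ n / 2" "0 < (1/2::real) ^ n"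
        by (simp_all add: power_add power_divide)
      ultimately show ?case using Suc by linarith
    qed
    moreover have "0 < (1/2::real) ^ n" by simp
    ultimately show ?thesis by linarith
  qed
qed

section \<open>Measure estimates on unit segments and on the torus\<close>

lemma (in prob_space) prob_avoid_all_ge:
  assumes S: "\<And>n. S n \<in> events" and le: "\<And>n. prob (S n) \<le> c n" and c: "c sums s"
  shows "1 - s \<le> prob (space M - (\<Union>n. S n))"
proof -
  have summ: "summable (\<lambda>n. prob (S n))"
    by (rule summable_comparison_test'[OF sums_summable[OF c], of 0])
       (simp only: real_norm_def measure_nonneg abs_of_nonneg le)
  have "prob (\<Union>n. S n) \<le> (\<Sum>n. prob (S n))"
    using S summ by (intro finite_measure_subadditive_countably) auto
  also have "\<dots> \<le> (\<Sum>n. c n)"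
    by (intro suminf_le le summ sums_summable[OF c])
  also have "\<dots> = s" by (rule sums_unique[OF c, symmetric])
  finally show ?thesis using S by (subst prob_compl) auto
qed

text \<open>The coefficient 1/8 is 32 * 4^-4, from the time bound 16 (2 r_n). The same series also
  dominates the areas of the outer balls, so one union bound serves both the segments and the
  torus.\<close>

lemma sums_eighth_quarter_powers: "(\<lambda>n. (1/8) * (1/4) ^ n :: real) sums (1/6)"
  using sums_mult[OF geometric_sums[of "1/4::real"], of "1/8"] by simp

lemma torus_gamma_line_integral_ge:
  assumes r: "\<And>n. r n = (1/4) ^ (n + 4)" and \<nu>: "norm \<nu> = 1"
  shows "1/2 \<le> (LBINT t=0..1. torus_gamma p r (torus_translate x (t *\<^sub>R \<nu>)))"
proof -
  \<comment> \<open>As a probability space, the unit interval of times falls under the union bound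
    \<open>prob_avoid_all_ge\<close>.\<close>
  define M where "M = restrict_space lborel {0<..<1::real}"
  interpret M: prob_space M
    unfolding M_def by (rule prob_space_restrict_space) auto
  have rpos: "0 < r n" for n by (simp add: r)
  have rle: "r n \<le> 1/4" for n
    using power_decreasing[of 1 "n + 4" "1/4::real"] by (simp add: r)
  define S where "S n = {t \<in> {0<..<1}. torus_dist (p n) (torus_translate x (t *\<^sub>R \<nu>)) < 2 * r n}" for n
  let ?G = "\<lambda>t. torus_gamma p r (torus_translate x (t *\<^sub>R \<nu>))"
  have Gm [measurable]: "?G \<in> borel_measurable M"
    unfolding M_def by (intro measurable_restrict_space1) measurable
  have Sb: "S n \<in> sets borel" for n
    using measurable_sets[OF measurable_torus_line borel_torus_ball, of x \<nu> "p n" "2 * r n"]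
    by (simp add: S_def Collect_conj_eq vimage_def)
  have Sm: "S n \<in> sets M" for n
    using Sb[of n] unfolding M_def by (subst sets_restrict_space_iff) (auto simp: S_def)
  have le: "measure M (S n) \<le> (1/8) * (1/4) ^ n" for n
  proof -
    have "measure M (S n) = measure lborel (S n)"
      unfolding M_def by (rule measure_restrict_space) (auto simp: S_def)
    also have "\<dots> \<le> 16 * (2 * r n)"
      unfolding S_def using rpos[of n] rle[of n] \<nu> by (intro measure_line_torus_ball_le) auto
    finally show ?thesis by (simp add: r power_add power_divide)
  qed
  have "1/2 \<le> measure M (space M - (\<Union>n. S n))"
    using M.prob_avoid_all_ge[OF Sm le sums_eighth_quarter_powers] by linarith
  also have "\<dots> = (\<integral>t. indicator (space M - (\<Union>n. S n)) t \<partial>M)"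
    using Sm by (simp add: Int_absorb2)
  also have "\<dots> \<le> (\<integral>t. ?G t \<partial>M)"
  proof (rule integral_mono)
    show "integrable M (\<lambda>t. indicator (space M - (\<Union>n. S n)) t :: real)"
      using Sm by (intro M.integrable_const_bound[of _ 1]) (auto simp: indicator_def)
    show "integrable M ?G"
      using torus_gamma_bounds[of p r] by (intro M.integrable_const_bound[of _ 1]) auto
    \<comment> \<open>At a time outside every \<open>S n\<close> all bumps vanish, so the integrand
      is 1; at all other times it is at least 0.\<close>
    show "indicator (space M - (\<Union>n. S n)) t \<le> ?G t" if "t \<in> space M" for t
    proof (cases "t \<in> (\<Union>n. S n)")
      case False
      then have "?G t = 1"
        using that rpos by (intro torus_gamma_eq_1 torus_bump_eq_0) (auto simp: S_def M_def)
      then show ?thesis by (simp add: indicator_def)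
    qed (use torus_gamma_bounds in auto)
  qed
  also have "\<dots> = (LBINT t=0..1. ?G t)"
    by (simp add: M_def integral_restrict_space interval_integral_Ioo set_lebesgue_integral_def)
  finally show ?thesis .
qed

lemma torus_gamma_eq_1_measure:
  assumes r: "\<And>n. r n = (1/4) ^ (n + 4)"
  shows "1/2 \<le> measure torus_measure {x. torus_gamma p r x = 1}"
proof -
  have rpos: "0 < r n" for n by (simp add: r)
  have rle: "r n \<le> 1/256" for n
    using power_decreasing[of 4 "n + 4" "1/4::real"] by (simp add: r power_divide)
  define S where "S n = {x. torus_dist (p n) x < 2 * r n}" for n
  have Sm: "S n \<in> sets torus_measure" for n by (simp add: S_def)
  have le: "measure torus_measure (S n) \<le> (1/8) * (1/4) ^ n" for n
  proof -
    have "measure torus_measure (S n) \<le> 36 * (2 * r n)\<^sup>2"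
      unfolding S_def using rpos[of n] rle[of n] by (intro measure_torus_ball_le) auto
    \<comment> \<open>The area is quadratic in \<open>r n\<close>; bounding one factor by 1/256
      leaves a linear term that fits the geometric series.\<close>
    also have "\<dots> = 144 * r n * r n" by (simp add: power2_eq_square)
    also have "\<dots> \<le> 144 * (1/256) * r n"
      using rpos[of n] rle[of n] by (intro mult_right_mono mult_left_mono) auto
    also have "\<dots> = (9/4096) * (1/4) ^ n" by (simp add: r power_add power_divide)
    also have "\<dots> \<le> (1/8) * (1/4) ^ n" by (intro mult_right_mono) auto
    finally show ?thesis .
  qed
  have "1/2 \<le> measure torus_measure (space torus_measure - (\<Union>n. S n))"
    using torus.prob_avoid_all_ge[OF Sm le sums_eighth_quarter_powers] by linarith
  also have "\<dots> \<le> measure torus_measure {x. torus_gamma p r x = 1}"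
  proof (rule torus.finite_measure_mono)
    show "space torus_measure - (\<Union>n. S n) \<subseteq> {x. torus_gamma p r x = 1}"
      using rpos by (auto simp: S_def intro!: torus_gamma_eq_1 torus_bump_eq_0)
    show "{x. torus_gamma p r x = 1} \<in> sets torus_measure"
      using measurable_sets[OF measurable_torus_gamma, of "{1}" p r] by (simp add: vimage_def)
  qed
  finally show ?thesis .
qed

text \<open>A representative in the fundamental square may lie on its boundary, but it is always in
  the closure of the open unit box. The open preimage of \<open>U\<close> therefore meets that box
  in a nonempty open set, which is not negligible.\<close>

lemma emeasure_torus_open_pos:
  assumes "open U" "U \<noteq> {}"
  shows "0 < emeasure torus_measure U"
proof -
  obtain x where x: "x \<in> U" using assms(2) by blast
  obtain y where y: "x = torus_of y" by (rule torus_of_cases)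
  let ?z = "\<chi> i. frac (y $ i)"
  have "torus_of ?z = torus_of y"
    by (simp add: torus_of_eq_iff int_lattice_def frac_def)
  then have zU: "?z \<in> torus_of -` U" using x y by simp
  have op: "open (torus_of -` U)" using assms(1) by (simp add: open_torus_def)
  have bx: "box 0 1 \<subseteq> fundamental_square"
    by (auto simp: fundamental_square_def mem_box_cart less_imp_le)
  have "(1/2) *\<^sub>R 1 \<in> (box 0 1 :: (real^2) set)" by (simp add: mem_box_cart)
  then have "closure (box 0 1) = (cbox 0 1 :: (real^2) set)"
    by (intro closure_box) blast
  moreover have "?z \<in> cbox 0 1"
    by (simp add: mem_box_cart frac_ge_0 less_imp_le frac_lt_1)
  ultimately have "torus_of -` U \<inter> box 0 1 \<noteq> {}"
    using zU open_Int_closure_eq_empty[OF op, of "box 0 1"] by auto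
  moreover have opb: "open (torus_of -` U \<inter> box 0 1)"
    using op by (intro open_Int open_box)
  ultimately have "torus_of -` U \<inter> box 0 1 \<notin> null_sets lborel"
    using open_not_negligible by (auto simp only: negligible_iff_null_sets dest: null_sets_completionI)
  then have "emeasure lborel (torus_of -` U \<inter> box 0 1) \<noteq> 0"
    using opb by (auto simp: null_sets_def)
  moreover have "emeasure lborel (torus_of -` U \<inter> box 0 1) \<le> emeasure torus_measure U"
    using assms(1) op bx fundamental_square_borel
    by (subst emeasure_torus_measure) (auto intro!: emeasure_mono)
  ultimately show ?thesis by (metis gr_zeroI le_zero_eq)
qed

text \<open>A property that holds almost everywhere has a witness in every Borel set of positive
  measure, in particular in every nonempty open set. Since \<open>Z\<close> is open and dense, such
  witnesses can be found in \<open>Z\<close> inside any nonempty open set, where \<open>f\<close> is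
  0, and also in \<open>A\<close>, where \<open>f\<close> is 1.\<close>

lemma torus_zero_on_dense_open:
  fixes f :: "torus \<Rightarrow> real"
  assumes Z: "open Z" "closure Z = UNIV" and f0: "\<And>x. x \<in> Z \<Longrightarrow> f x = 0"
    and A: "A \<in> sets torus_measure" "0 < emeasure torus_measure A" and f1: "\<And>x. x \<in> A \<Longrightarrow> f x = 1"
  shows "\<not> (\<exists>c. AE x in torus_measure. f x = c)"
    and "\<not> (\<exists>g :: torus \<Rightarrow> real. continuous_on UNIV g \<and> (AE x in torus_measure. g x = f x))"
    and "open U \<Longrightarrow> U \<noteq> {} \<Longrightarrow> \<not> (\<exists>c>0. AE x in torus_measure. x \<in> U \<longrightarrow> c \<le> f x)"
proof -
  have posD: "\<exists>x\<in>B. P x" if "AE x in torus_measure. P x" "B \<in> sets borel" "0 < emeasure torus_measure B" for P B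
  proof (rule ccontr)
    assume "\<not> ?thesis"
    then have "AE x in torus_measure. x \<notin> B" using that(1) by (auto elim!: eventually_mono)
    then have "emeasure torus_measure B = 0"
      using AE_iff_measurable[of B torus_measure "\<lambda>x. x \<notin> B"] that(2) by simp
    then show False using that(3) by simp
  qed
  have openD: "\<exists>x\<in>V. P x" if "AE x in torus_measure. P x" "open V" "V \<noteq> {}" for P V
    using that by (intro posD emeasure_torus_open_pos) auto
  have Zmeets: "V \<inter> Z \<noteq> {}" if "open V" "V \<noteq> {}" for V
    using that Z(2) open_Int_closure_eq_empty[of V Z] by auto
  have Zne: "Z \<noteq> {}" using Z(2) by auto
  have Ab: "A \<in> sets borel" using A(1) by simp
  show "\<not> (\<exists>c. AE x in torus_measure. f x = c)"
  proof
    assume "\<exists>c. AE x in torus_measure. f x = c"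
    then obtain c where c: "AE x in torus_measure. f x = c" ..
    from openD[OF c Z(1) Zne] have "c = 0" using f0 by auto
    moreover from posD[OF c Ab A(2)] have "c = 1" using f1 by auto
    ultimately show False by simp
  qed
  show "\<not> (\<exists>g :: torus \<Rightarrow> real. continuous_on UNIV g \<and> (AE x in torus_measure. g x = f x))"
  proof
    assume "\<exists>g :: torus \<Rightarrow> real. continuous_on UNIV g \<and> (AE x in torus_measure. g x = f x)"
    then obtain g :: "torus \<Rightarrow> real" where g: "continuous_on UNIV g" "AE x in torus_measure. g x = f x"
      by blast
    have V: "open {x. g x \<noteq> 0}" using g(1) by (intro open_Collect_neq) auto
    \<comment> \<open>If this open set were nonempty, it would meet \<open>Z\<close> in a nonempty
      open set, where \<open>g\<close> agrees with \<open>f = 0\<close> at some point. So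
      \<open>g\<close> vanishes identically, which contradicts its agreement with
      \<open>f = 1\<close> at a point of \<open>A\<close>.\<close>
    have "{x. g x \<noteq> 0} = {}"
    proof (rule ccontr)
      assume "{x. g x \<noteq> 0} \<noteq> {}"
      then have "{x. g x \<noteq> 0} \<inter> Z \<noteq> {}" by (rule Zmeets[OF V])
      then have "\<exists>x\<in>{x. g x \<noteq> 0} \<inter> Z. g x = f x"
        using V Z(1) by (intro openD[OF g(2)]) auto
      then show False using f0 by auto
    qed
    moreover obtain x where "x \<in> A" "g x = f x" using posD[OF g(2) Ab A(2)] by blast
    ultimately show False using f1[of x] by auto
  qed
  show "\<not> (\<exists>c>0. AE x in torus_measure. x \<in> U \<longrightarrow> c \<le> f x)" if U: "open U" "U \<noteq> {}"
  proof
    assume "\<exists>c>0. AE x in torus_measure. x \<in> U \<longrightarrow> c \<le> f x"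
    then obtain c where c: "0 < c" "AE x in torus_measure. x \<in> U \<longrightarrow> c \<le> f x" by blast
    have "\<exists>x\<in>U \<inter> Z. x \<in> U \<longrightarrow> c \<le> f x"
      using U Z(1) Zmeets[OF U] by (intro openD[OF c(2)]) auto
    then show False using c(1) f0 by fastforce
  qed
qed

theorem proposition5p1:
  "\<exists>(\<gamma> :: torus \<Rightarrow> real) (c\<^sub>0 :: real).
     \<gamma> \<in> borel_measurable borel \<and>
     (\<forall>x. 0 \<le> \<gamma> x) \<and>
     (\<lambda>x. complex_of_real (\<gamma> x)) \<in> sobolev_torus (1/2) \<inter> Linf_torus \<and>
     0 < c\<^sub>0 \<and>
     (INF x. INF \<nu>\<in>sphere (0 :: real ^ 2) 1.
        LBINT t=0..1. \<gamma> (torus_translate x (t *\<^sub>R \<nu>))) \<ge> c\<^sub>0 \<and>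
     (\<exists>Z A. open Z \<and> closure Z = UNIV \<and>
        A \<in> sets torus_measure \<and> 0 < emeasure torus_measure A \<and>
        (\<forall>x\<in>Z. \<gamma> x = 0) \<and> (\<forall>x\<in>A. \<gamma> x = 1)) \<and>
     \<not> (\<exists>c. AE x in torus_measure. \<gamma> x = c) \<and>
     \<not> (\<exists>g :: torus \<Rightarrow> real. continuous_on UNIV g \<and> (AE x in torus_measure. g x = \<gamma> x)) \<and>
     (\<forall>U. open U \<and> U \<noteq> {} \<longrightarrow>
        \<not> (\<exists>c>0. AE x in torus_measure. x \<in> U \<longrightarrow> c \<le> \<gamma> x))"
proof -
  \<comment> \<open>Density in the plane suffices: the preimage of a nonempty open subset of the
    torus is open and nonempty, so it contains some \<open>p n\<close>.\<close>
  obtain D :: "(real^2) set" where D: "countable D" "\<And>X. open X \<Longrightarrow> X \<noteq> {} \<Longrightarrow> \<exists>d\<in>D. d \<in> X"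
    by (rule countable_dense_setE) blast
  have Dne: "D \<noteq> {}" using D(2)[of UNIV] by auto
  define p where "p = from_nat_into D"
  have p: "\<exists>n. p n \<in> X" if "open X" "X \<noteq> {}" for X
    using D(2)[OF that] range_from_nat_into[OF Dne D(1)] unfolding p_def by (metis rangeE)
  define r where "r n = (1/4::real) ^ (n + 4)" for n
  have rpos: "0 < r n" for n by (simp add: r_def)
  define \<gamma> where "\<gamma> = torus_gamma p r"
  define Z where "Z = (\<Union>n. {x. torus_dist (p n) x < r n})"
  define A where "A = {x. \<gamma> x = 1}"
  have \<gamma>m [measurable]: "\<gamma> \<in> borel_measurable borel"
    by (simp add: \<gamma>_def)
  have \<gamma>_bounds: "0 \<le> \<gamma> x" "\<gamma> x \<le> 1" for x
    by (simp_all add: \<gamma>_def torus_gamma_bounds)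
  have Zo: "open Z" unfolding Z_def by (intro open_UN ballI open_torus_ball)
  have Zd: "closure Z = UNIV"
  proof -
    have "V \<inter> Z \<noteq> {}" if "open V" "x \<in> V" for V x
    proof -
      have "open (torus_of -` V)" using that(1) by (simp add: open_torus_def)
      moreover have "torus_of -` V \<noteq> {}"
        using that(2) by (cases x rule: torus_of_cases) auto
      ultimately obtain n where "torus_of (p n) \<in> V" using p by blast
      moreover have "torus_of (p n) \<in> Z"
        unfolding Z_def by (rule UN_I[of n]) (simp_all add: torus_dist_self rpos)
      ultimately show ?thesis by blast
    qed
    \<comment> \<open>The complement of the closure is open and disjoint from \<open>Z\<close>,
      hence empty.\<close>
    from this[of "- closure Z"] show ?thesis
      using closure_subset[of Z] by (auto simp: open_Compl)
  qed
  have Z0: "\<gamma> x = 0" if "x \<in> Z" for x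
    using that rpos unfolding Z_def \<gamma>_def by (auto intro: torus_gamma_eq_0 torus_bump_eq_1)
  have Am: "A \<in> sets torus_measure" 
    using measurable_sets[OF \<gamma>m, of "{1}"] by (simp add: A_def vimage_def)
  have "1/2 \<le> measure torus_measure A"
    unfolding A_def \<gamma>_def by (rule torus_gamma_eq_1_measure) (simp add: r_def)
  then have Apos: "0 < emeasure torus_measure A"
    by (simp add: torus.emeasure_eq_measure)
  have "(\<lambda>x. complex_of_real (\<gamma> x)) \<in> sobolev_torus (1/2)"
    unfolding \<gamma>_def by (rule torus_gamma_sobolev) (simp add: r_def)
  moreover have "(\<lambda>x. complex_of_real (\<gamma> x)) \<in> Linf_torus"
    using \<gamma>_bounds
    by (auto simp: Linf_torus_def measurable_cong_sets[OF sets_torus_measure refl] intro!: exI[of _ 1])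
  moreover have "1/2 \<le> (INF x. INF \<nu>\<in>sphere (0 :: real ^ 2) 1.
        LBINT t=0..1. \<gamma> (torus_translate x (t *\<^sub>R \<nu>)))"
  proof (intro cINF_greatest)
    \<comment> \<open>For reals \<open>INF\<close> has this greatest-lower-bound property only over
      a nonempty index set, so a unit vector must be exhibited.\<close>
    have "axis 1 1 \<in> sphere (0 :: real ^ 2) 1" by (simp add: norm_axis_1)
    then show "sphere (0 :: real ^ 2) 1 \<noteq> {}" by blast
    show "1/2 \<le> (LBINT t=0..1. \<gamma> (torus_translate x (t *\<^sub>R \<nu>)))" if "\<nu> \<in> sphere 0 1" for x \<nu>
      unfolding \<gamma>_def using that by (intro torus_gamma_line_integral_ge) (auto simp: r_def)
  qed simp
  moreover have A1: "\<gamma> x = 1" if "x \<in> A" for x using that by (simp add: A_def)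
  moreover note torus_zero_on_dense_open[OF Zo Zd Z0 Am Apos A1]
  ultimately show ?thesis
    using \<gamma>m \<gamma>_bounds Zo Zd Z0 Am Apos
    by (intro exI[of _ \<gamma>] exI[of _ "1/2::real"] conjI exI[of _ Z] exI[of _ A]) auto
qed

end
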